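(* Let ${\bf u},{\bf v}\in\mathbb{R}^n$ be vectors with $|{\bf u}\wedge{\bf v}|=1$, and let $\theta$ be any real scalar. Then $$\exp(\theta\,{\bf u}\wedge{\bf v})=I-(1-\cos\theta)\,\mathrm{proj}_{{\bf u}{\bf v}}+\sin\theta\,{\bf u}\wedge{\bf v}.$$
   Context: For ${\bf u},{\bf v}\in\mathbb{R}^n$, the outer product ${\bf u}\otimes{\bf v}$ is the linear map $({\bf u}\otimes{\bf v})({\bf w})=({\bf v}\cdot{\bf w}){\bf u}$, and the wedge product is the linear map ${\bf u}\wedge{\bf v}={\bf u}\otimes{\bf v}-{\bf v}\otimes{\bf u}$. Its norm is $|{\bf u}\wedge{\bf v}|=\sqrt{|{\bf u}|^2|{\bf v}|^2-({\bf u}\cdot{\bf v})^2}$. $\mathrm{proj}_{{\bf u}{\bf v}}$ is the orthogonal projection onto the plane spanned by ${\bf u}$ and ${\bf v}$. $\exp(A)=\sum_{k\ge0}A^k/k!$ and $I$ is the identity. *)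

theory Defs
  imports "HOL-Analysis.Analysis"
begin

lift_definition outer_prod :: "'a::euclidean_space \<Rightarrow> 'a \<Rightarrow> 'a \<Rightarrow>\<^sub>L 'a"
  is "\<lambda>u v w. (v \<bullet> w) *\<^sub>R u"
  by (intro bounded_linear_intros)

definition wedge :: "'a::euclidean_space \<Rightarrow> 'a \<Rightarrow> 'a \<Rightarrow>\<^sub>L 'a"
  where "wedge u v = outer_prod u v - outer_prod v u"

(* A function of the pair (u, v), kept separate from the operator norm that
   the type of bounded linear maps carries. *)
definition wedge_norm :: "'a::euclidean_space \<Rightarrow> 'a \<Rightarrow> real"
  where "wedge_norm u v = sqrt ((norm u)\<^sup>2 * (norm v)\<^sup>2 - (u \<bullet> v)\<^sup>2)"

lemma ex1_orthogonal_projection: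
  fixes S :: "'a::euclidean_space set"
  shows "\<exists>!y. y \<in> span S \<and> (\<forall>z\<in>span S. orthogonal (x - y) z)"
proof (rule ex_ex1I)
  obtain y z where "y \<in> span S" "\<And>w. w \<in> span S \<Longrightarrow> orthogonal z w" "x = y + z"
    using orthogonal_subspace_decomp_exists[of S x] by metis
  then show "\<exists>y. y \<in> span S \<and> (\<forall>z\<in>span S. orthogonal (x - y) z)"
    by (intro exI[of _ y]) auto
next
  fix y y'
  assume y: "y \<in> span S \<and> (\<forall>z\<in>span S. orthogonal (x - y) z)"
    and y': "y' \<in> span S \<and> (\<forall>z\<in>span S. orthogonal (x - y') z)"
  then have "y - y' \<in> span S"
    by (simp add: span_diff)
  with y y' have "(x - y') \<bullet> (y - y') = 0" "(x - y) \<bullet> (y - y') = 0"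
    by (auto simp: orthogonal_def)
  then have "(y - y') \<bullet> (y - y') = 0"
    by (simp add: inner_diff_left)
  then show "y = y'" by simp
qed

lift_definition proj_span :: "'a::euclidean_space set \<Rightarrow> 'a \<Rightarrow>\<^sub>L 'a"
  is "\<lambda>S x. THE y. y \<in> span S \<and> (\<forall>z\<in>span S. orthogonal (x - y) z)"
proof -
  fix S :: "'a set"
  define P where "P = (\<lambda>x. THE y. y \<in> span S \<and> (\<forall>z\<in>span S. orthogonal (x - y) z))"
  have P: "P x \<in> span S \<and> (\<forall>z\<in>span S. orthogonal (x - P x) z)" for x
    unfolding P_def by (rule theI') (rule ex1_orthogonal_projection)
  have PI: "P x = y" if "y \<in> span S" "\<And>z. z \<in> span S \<Longrightarrow> orthogonal (x - y) z" for x y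
    using ex1_orthogonal_projection[of S x] P[of x] that by blast
  have "linear P"
  proof (rule linearI)
    fix x y
    show "P (x + y) = P x + P y"
      using P[of x] P[of y]
      by (intro PI) (auto simp: span_add orthogonal_def inner_simps)
  next
    fix c x
    show "P (c *\<^sub>R x) = c *\<^sub>R P x"
      using P[of x]
      by (intro PI) (auto simp: span_scale orthogonal_def inner_simps)
  qed
  then show "bounded_linear P"
    by (rule linear_conv_bounded_linear[THEN iffD1])
qed

lemma proj_span_in: "proj_span S x \<in> span S"
  and proj_span_orthogonal: "z \<in> span S \<Longrightarrow> orthogonal (x - proj_span S x) z"
  using theI'[OF ex1_orthogonal_projection[of S x]] by (auto simp: proj_span.rep_eq)

primrec blinfun_power :: "('a::real_normed_vector \<Rightarrow>\<^sub>L 'a) \<Rightarrow> nat \<Rightarrow> ('a \<Rightarrow>\<^sub>L 'a)"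
  where
    "blinfun_power A 0 = id_blinfun"
  | "blinfun_power A (Suc k) = A o\<^sub>L blinfun_power A k"

(* The overloaded exp needs a real normed algebra, an instance that the type of
   bounded linear maps does not have. *)
definition blinfun_exp :: "('a::banach \<Rightarrow>\<^sub>L 'a) \<Rightarrow> ('a \<Rightarrow>\<^sub>L 'a)"
  where "blinfun_exp A = (\<Sum>k. blinfun_power A k /\<^sub>R fact k)"

lemma norm_blinfun_power_le: "norm (blinfun_power A k) \<le> norm A ^ k"
proof (induction k)
  case 0
  show ?case by (simp add: norm_blinfun_id_le)
next
  case (Suc k)
  have "norm (blinfun_power A (Suc k)) \<le> norm A * norm (blinfun_power A k)"
    by (simp add: norm_blinfun_compose)
  also have "\<dots> \<le> norm A * norm A ^ k"
    using Suc by (intro mult_left_mono) auto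
  finally show ?case by simp
qed

lemma summable_blinfun_exp:
  fixes A :: "'a::banach \<Rightarrow>\<^sub>L 'a"
  shows "summable (\<lambda>k. blinfun_power A k /\<^sub>R fact k)"
proof (rule summable_comparison_test')
  show "summable (\<lambda>k. norm A ^ k /\<^sub>R fact k)"
    by (rule summable_exp_generic)
  show "norm (blinfun_power A k /\<^sub>R fact k) \<le> norm A ^ k /\<^sub>R fact k" if "k \<ge> 0" for k
    using norm_blinfun_power_le[of A k] by (simp add: divide_right_mono)
qed

end

theory Submission
  imports Defs
begin

text \<open>
  The unit bivector \<open>J = u \<and> v\<close> acts on the plane spanned by \<open>u\<close> and \<open>v\<close> as a rotation by a right
  angle and kills the orthogonal complement of that plane. With \<open>P\<close> the projection onto the plane
  this says \<open>J\<^sup>2 = - P\<close> (\<open>wedge_compose_wedge\<close>) and \<open>J P = J\<close> (\<open>wedge_compose_proj_span\<close>): on the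
  plane, \<open>J\<close> plays the role of the imaginary unit and \<open>P\<close> the role of \<open>1\<close>.

  These two relations alone determine the exponential (\<open>blinfun_exp_complex_structure\<close>). Splitting
  the identity as \<open>(I - P) + P\<close>, the part \<open>I - P\<close> is annihilated by \<open>J\<close> and so contributes only to the
  term of degree zero, while the powers of \<open>\<theta> J\<close> applied to \<open>P\<close> alternate between multiples of \<open>P\<close>
  and of \<open>J\<close>, with the Taylor coefficients of cosine and sine. Hence
  \<open>exp (\<theta> J) = (I - P) + cos \<theta> P + sin \<theta> J\<close>, as in Euler's formula.
\<close>

lemma wedge_apply: "wedge u v w = (v \<bullet> w) *\<^sub>R u - (u \<bullet> w) *\<^sub>R v"
  by (simp add: wedge_def outer_prod.rep_eq blinfun.diff_left)

lemma proj_span_eqI: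
  assumes "y \<in> span S" "\<And>z. z \<in> S \<Longrightarrow> (x - y) \<bullet> z = 0"
  shows "proj_span S x = y"
proof -
  have "orthogonal (x - y) z" if "z \<in> span S" for z
    using that by (rule orthogonal_to_span) (simp add: assms(2) orthogonal_def)
  with assms(1) show ?thesis
    unfolding proj_span.rep_eq by (intro the1_equality ex1_orthogonal_projection) simp
qed

text \<open>
  The residue \<open>x - P x\<close> is orthogonal to \<open>u\<close> and \<open>v\<close>, and the value of \<open>u \<and> v\<close> at a vector depends
  only on the inner products of that vector with \<open>u\<close> and \<open>v\<close>.
\<close>

lemma wedge_compose_proj_span: "wedge u v o\<^sub>L proj_span {u, v} = wedge u v"
proof (rule blinfun_eqI)
  fix x
  have "z \<bullet> (x - proj_span {u, v} x) = 0" if "z \<in> {u, v}" for z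
    using proj_span_orthogonal[of z "{u, v}" x] that span_base[of z "{u, v}"]
    by (simp add: orthogonal_def inner_commute)
  from this[of u] this[of v]
  have "u \<bullet> proj_span {u, v} x = u \<bullet> x" "v \<bullet> proj_span {u, v} x = v \<bullet> x"
    by (simp_all add: inner_diff_right)
  then show "(wedge u v o\<^sub>L proj_span {u, v}) x = wedge u v x"
    by (simp add: wedge_apply)
qed

text \<open>
  The vector \<open>- J (J x)\<close> lies in the span because the range of \<open>J = u \<and> v\<close> does. That
  \<open>x + J (J x)\<close> is orthogonal to \<open>u\<close> and \<open>v\<close> is the expansion of the inner products, where the
  Gram determinant of \<open>u\<close> and \<open>v\<close>, which is the square of the norm of the bivector, appears as a
  factor: for instance \<open>J (J x) \<bullet> u = ((u \<bullet> v)\<^sup>2 - \<bar>u\<bar>\<^sup>2 \<bar>v\<bar>\<^sup>2) (x \<bullet> u)\<close>.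
\<close>

lemma wedge_compose_wedge:
  assumes "wedge_norm u v = 1"
  shows "wedge u v o\<^sub>L wedge u v = - proj_span {u, v}"
proof (rule blinfun_eqI)
  fix x
  let ?y = "- wedge u v (wedge u v x)"
  have gram: "(u \<bullet> u) * (v \<bullet> v) = 1 + (u \<bullet> v) * (u \<bullet> v)"
    using assms
    by (simp add: wedge_norm_def power2_norm_eq_inner)
       (simp add: power2_eq_square)
  have "proj_span {u, v} x = ?y"
  proof (rule proj_span_eqI)
    show "?y \<in> span {u, v}"
      unfolding wedge_apply[of u v "wedge u v x"]
      by (intro span_neg span_diff span_scale span_base) auto
    have "(x - ?y) \<bullet> u = (x \<bullet> u) * (1 + (u \<bullet> v) * (u \<bullet> v) - (u \<bullet> u) * (v \<bullet> v))"
         "(x - ?y) \<bullet> v = (x \<bullet> v) * (1 + (u \<bullet> v) * (u \<bullet> v) - (u \<bullet> u) * (v \<bullet> v))"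
      by (simp_all add: wedge_apply inner_simps inner_commute[of v u] inner_commute[of x]
          algebra_simps)
    then show "(x - ?y) \<bullet> z = 0" if "z \<in> {u, v}" for z
      using that gram by auto
  qed
  then show "(wedge u v o\<^sub>L wedge u v) x = (- proj_span {u, v}) x"
    by (simp add: blinfun.minus_left)
qed

text \<open>
  The recurrences \<open>c\<^sub>k\<^sub>+\<^sub>1 = - s\<^sub>k / (k + 1)\<close> and \<open>s\<^sub>k\<^sub>+\<^sub>1 = c\<^sub>k / (k + 1)\<close> of the Taylor coefficients of
  cosine and sine match the effect of \<open>J\<close> on multiples of \<open>P\<close> and \<open>J\<close>. This gives every term of the
  exponential series at once, without separating even from odd powers.
\<close>

lemma blinfun_exp_term_complex_structure:
  fixes J P :: "'a::real_normed_vector \<Rightarrow>\<^sub>L 'a"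
  assumes JJ: "J o\<^sub>L J = - P" and JP: "J o\<^sub>L P = J"
  shows "blinfun_power (\<theta> *\<^sub>R J) k /\<^sub>R fact k
       = (if k = 0 then id_blinfun - P else 0)
         + (cos_coeff k *\<^sub>R \<theta> ^ k) *\<^sub>R P + (sin_coeff k *\<^sub>R \<theta> ^ k) *\<^sub>R J"
proof (induction k)
  case 0
  show ?case by simp
next
  case (Suc k)
  have J_simps: "J (J x) = - P x" "J (P x) = J x" for x
    using arg_cong[OF JJ, of "\<lambda>A. blinfun_apply A x"] arg_cong[OF JP, of "\<lambda>A. blinfun_apply A x"]
    by (simp_all add: blinfun.minus_left)
  have "blinfun_power (\<theta> *\<^sub>R J) (Suc k) /\<^sub>R fact (Suc k)
      = (\<theta> / real (Suc k)) *\<^sub>R (J o\<^sub>L (blinfun_power (\<theta> *\<^sub>R J) k /\<^sub>R fact k))"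
    by (rule blinfun_eqI)
       (simp add: blinfun.scaleR_left blinfun.scaleR_right divide_inverse ac_simps)
  also have "J o\<^sub>L (blinfun_power (\<theta> *\<^sub>R J) k /\<^sub>R fact k)
      = (cos_coeff k * \<theta> ^ k) *\<^sub>R J - (sin_coeff k * \<theta> ^ k) *\<^sub>R P"
    unfolding Suc.IH
    by (rule blinfun_eqI)
       (simp add: blinfun.add_left blinfun.diff_left blinfun.scaleR_left blinfun.add_right
          blinfun.diff_right blinfun.scaleR_right J_simps)
  also have "(\<theta> / real (Suc k)) *\<^sub>R \<dots>
      = (cos_coeff (Suc k) * \<theta> ^ Suc k) *\<^sub>R P + (sin_coeff (Suc k) * \<theta> ^ Suc k) *\<^sub>R J"
    by (simp add: cos_coeff_Suc sin_coeff_Suc scaleR_diff_right mult_ac del: of_nat_Suc)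
  finally show ?case by simp
qed

lemma blinfun_exp_complex_structure:
  fixes J P :: "'a::banach \<Rightarrow>\<^sub>L 'a"
  assumes "J o\<^sub>L J = - P" "J o\<^sub>L P = J"
  shows "blinfun_exp (\<theta> *\<^sub>R J) = id_blinfun - (1 - cos \<theta>) *\<^sub>R P + sin \<theta> *\<^sub>R J"
proof -
  have "(\<lambda>k. blinfun_power (\<theta> *\<^sub>R J) k /\<^sub>R fact k)
      sums ((id_blinfun - P) + cos \<theta> *\<^sub>R P + sin \<theta> *\<^sub>R J)"
    unfolding blinfun_exp_term_complex_structure[OF assms]
    by (intro sums_add sums_scaleR_left cos_converges sin_converges)
       (rule sums_single[of 0 "\<lambda>_. id_blinfun - P"])
  then show ?thesis
    unfolding blinfun_exp_def by (simp add: sums_iff scaleR_diff_left)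
qed

theorem theorem3p2:
  fixes u v :: "real ^ 'n" and \<theta> :: real
  assumes "wedge_norm u v = 1"
  shows "blinfun_exp (\<theta> *\<^sub>R wedge u v)
       = id_blinfun - (1 - cos \<theta>) *\<^sub>R proj_span {u, v} + sin \<theta> *\<^sub>R wedge u v"
  using wedge_compose_wedge[OF assms] wedge_compose_proj_span
  by (rule blinfun_exp_complex_structure)

end
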